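(* Let $n\ge 1$, $I=\{1,\ldots,n\}$, $V\in\mathbb{R}_{\ge 0}^{n\times n}$, let $X$ be the permutation matrix of a maximum weight perfect matching for $V$, let $V'=X^TV=(v'_{ij})$ and $u_{ij}=v'_{ij}-v'_{jj}$ for $i,j\in I$. For each $j\in I$ define the sequence $(y_j^{(t)})_{t\in\mathbb{N}}$ by $$y_j^{(0)}=0,\qquad y_j^{(t+1)}=\max_{k\in I}\{y_k^{(t)}+u_{jk}\}.$$ Then these sequences are convergent, and converge in at most $n-1$ steps, i.e. $y_j^{(t+1)}=y_j^{(t)}$ for all $j\in I$ and all $t\ge n-1$.
   Context: Maximum weight perfect matching: an $n\times n$ permutation matrix $X$ maximizing $\mathrm{tr}(X^TV)$ over all $n\times n$ permutation matrices. Here $\mathbb{N}$ includes $0$. *)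

theory Defs
  imports "HOL-Analysis.Analysis"
begin

definition permutation_matrix :: "real^'n^'n \<Rightarrow> bool" where
  "permutation_matrix X \<longleftrightarrow>
     (\<forall>i j. X $ i $ j \<in> {0, 1}) \<and>
     (\<forall>i. \<exists>!j. X $ i $ j = 1) \<and>
     (\<forall>j. \<exists>!i. X $ i $ j = 1)"

definition max_weight_perfect_matching :: "real^'n^'n \<Rightarrow> real^'n^'n \<Rightarrow> bool" where
  "max_weight_perfect_matching V X \<longleftrightarrow>
     is_arg_max (\<lambda>Y. trace (transpose Y ** V)) permutation_matrix X"

definition utility :: "real^'n^'n \<Rightarrow> real^'n^'n \<Rightarrow> real^'n^'n" where
  "utility X V = (let V' = transpose X ** V in \<chi> i j. V' $ i $ j - V' $ j $ j)"

primrec yseq :: "real^'n^'n \<Rightarrow> nat \<Rightarrow> 'n \<Rightarrow> real" where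
  "yseq U 0 j = 0"
| "yseq U (Suc t) j = (MAX k. yseq U t k + U $ j $ k)"

end

theory Submission
  imports Defs
begin

text \<open>
  The value of \<open>yseq U t j\<close> is the largest weight of a walk with \<open>t\<close> edges starting in \<open>j\<close>, and it
  grows with \<open>t\<close> because the loops have weight \<open>0\<close>. Optimality of \<open>X\<close> says that every permutation
  has non-positive weight under the utility matrix, hence so has every simple cycle. A walk with at
  least \<open>n\<close> edges contains a simple cycle, which can be cut out without lowering the weight, so the
  maximum is already attained by walks with at most \<open>n - 1\<close> edges.
\<close>

text \<open>Supplies the competitors against which the optimality of \<open>X\<close> is
  tested.\<close>

lemma permutation_matrix_permute_columns:
  fixes X :: "real^'n^'n" and \<rho> :: "'n \<Rightarrow> 'n"
  assumes X: "permutation_matrix X" and \<rho>: "bij \<rho>"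
  shows "permutation_matrix (\<chi> i j. X $ i $ \<rho> j)"
proof -
  have "\<exists>!j. X $ i $ \<rho> j = 1" for i
  proof -
    obtain j where j: "X $ i $ j = 1" "\<And>j'. X $ i $ j' = 1 \<Longrightarrow> j' = j"
      using X unfolding permutation_matrix_def by metis
    obtain k where k: "j = \<rho> k" using bij_is_surj[OF \<rho>] by (rule surjE)
    show ?thesis
    proof (rule ex1I)
      show "X $ i $ \<rho> k = 1" using j(1) k by simp
      show "k' = k" if "X $ i $ \<rho> k' = 1" for k'
        using j(2)[OF that] k injD[OF bij_is_inj[OF \<rho>]] by simp
    qed
  qed
  then show ?thesis using X by (simp add: permutation_matrix_def)
qed

lemma max_weight_sum_permutation_le:
  fixes V X :: "real^'n^'n"
  assumes X: "max_weight_perfect_matching V X" and \<pi>: "bij \<pi>"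
  shows "(\<Sum>i\<in>UNIV. (transpose X ** V) $ i $ \<pi> i) \<le> trace (transpose X ** V)"
proof -
  \<comment> \<open>Row \<open>j\<close> of \<open>transpose Y\<close> is row
    \<open>inv \<pi> j\<close> of \<open>transpose X\<close>, so the trace for \<open>Y\<close>
    collects the entries at \<open>(inv \<pi> j, j)\<close>, that is, at
    \<open>(i, \<pi> i)\<close>.\<close>
  define Y where "Y = (\<chi> i j. X $ i $ inv \<pi> j)"
  have "permutation_matrix Y"
    unfolding Y_def using X \<pi>
    by (intro permutation_matrix_permute_columns bij_imp_bij_inv)
      (auto simp: max_weight_perfect_matching_def is_arg_max_def)
  then have "trace (transpose Y ** V) \<le> trace (transpose X ** V)"
    using X unfolding max_weight_perfect_matching_def is_arg_max_linorder by blast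
  moreover have "trace (transpose Y ** V) = (\<Sum>i\<in>UNIV. (transpose X ** V) $ i $ \<pi> i)"
  proof -
    have "trace (transpose Y ** V) = (\<Sum>j\<in>UNIV. (transpose X ** V) $ inv \<pi> j $ j)"
      by (simp add: trace_def Y_def matrix_matrix_mult_def transpose_def)
    also have "\<dots> = (\<Sum>i\<in>UNIV. (transpose X ** V) $ i $ \<pi> i)"
      using \<pi> by (intro sum.reindex_bij_witness[where i = \<pi> and j = "inv \<pi>"])
        (auto simp: bij_is_inj bij_is_surj surj_f_inv_f)
    finally show ?thesis .
  qed
  ultimately show ?thesis by simp
qed

lemma utility_diagonal: "utility X V $ j $ j = 0"
  by (simp add: utility_def Let_def)

text \<open>The subtracted diagonal entries are merely reordered by \<open>\<pi>\<close>, so they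
  add up to the trace, which bounds the rest by optimality.\<close>

lemma sum_utility_permutation_nonpos:
  fixes V X :: "real^'n^'n"
  assumes X: "max_weight_perfect_matching V X" and \<pi>: "bij \<pi>"
  shows "(\<Sum>i\<in>UNIV. utility X V $ i $ \<pi> i) \<le> 0"
proof -
  have "(\<Sum>i\<in>UNIV. (transpose X ** V) $ \<pi> i $ \<pi> i) = trace (transpose X ** V)"
    unfolding trace_def by (rule sum.reindex_bij_betw[OF \<pi>])
  then show ?thesis
    using max_weight_sum_permutation_le[OF X \<pi>]
    by (simp add: utility_def Let_def sum_subtractf)
qed

text \<open>The cycle extends to a permutation that fixes all other vertices; the fixed points
  contribute only zero diagonal entries.\<close>

lemma simple_cycle_nonpos:
  fixes U :: "real^'n^'n" and p :: "nat \<Rightarrow> 'n"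
  assumes diag: "\<And>j. U $ j $ j = 0"
    and perm: "\<And>\<pi>. bij \<pi> \<Longrightarrow> (\<Sum>i\<in>UNIV. U $ i $ \<pi> i) \<le> 0"
    and inj: "inj_on p {a..<b}" and "a < b" and closed: "p a = p b"
  shows "(\<Sum>i = a..<b. U $ p i $ p (Suc i)) \<le> 0"
proof -
  let ?C = "p ` {a..<b}"
  define \<pi> where
    "\<pi> x = (if x \<in> ?C then p (Suc (the_inv_into {a..<b} p x)) else x)" for x
  have \<pi>_p: "\<pi> (p i) = p (Suc i)" if "i \<in> {a..<b}" for i
    using that by (simp add: \<pi>_def the_inv_into_f_f[OF inj])
  have "x \<in> range \<pi>" for x
  proof (cases "x \<in> ?C")
    case True
    then obtain i where i: "i \<in> {a..<b}" "x = p i" by blast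
    \<comment> \<open>The position before \<open>i\<close> on the cycle; since
      \<open>p a = p b\<close>, position \<open>a\<close> is preceded by
      \<open>b - 1\<close>.\<close>
    define k where "k = (if i = a then b - 1 else i - 1)"
    have "k \<in> {a..<b}" "p (Suc k) = x" using i \<open>a < b\<close> closed by (auto simp: k_def)
    then show ?thesis using \<pi>_p by (metis rangeI)
  next
    case False
    then have "\<pi> x = x" by (simp add: \<pi>_def)
    then show ?thesis by (metis rangeI)
  qed
  then have "surj \<pi>" by blast
  then have "bij \<pi>" by (simp add: bij_def finite_UNIV_surj_inj)
  have "(\<Sum>i = a..<b. U $ p i $ p (Suc i)) = (\<Sum>i = a..<b. U $ p i $ \<pi> (p i))"
    by (rule sum.cong) (simp_all add: \<pi>_p)
  also have "\<dots> = (\<Sum>x\<in>?C. U $ x $ \<pi> x)"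
    by (simp add: sum.reindex[OF inj])
  also have "\<dots> = (\<Sum>x\<in>UNIV. U $ x $ \<pi> x)"
    by (rule sum.mono_neutral_left) (auto simp: \<pi>_def diag)
  also have "\<dots> \<le> 0" by (rule perm[OF \<open>bij \<pi>\<close>])
  finally show ?thesis .
qed

lemma yseq_Suc_ge: "yseq U t k + U $ j $ k \<le> yseq U (Suc t) j"
  by (simp add: Max_ge)

text \<open>Prefixing a walk of \<open>k\<close> edges to an optimal walk of \<open>t\<close> edges
  gives a candidate of length \<open>t + k\<close>. With \<open>t = 0\<close> this bounds the weight
  of the walk alone.\<close>

lemma yseq_walk_le:
  "(\<Sum>i = a..<a + k. U $ p i $ p (Suc i)) + yseq U t (p (a + k)) \<le> yseq U (t + k) (p a)"
proof (induction k arbitrary: t)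
  case (Suc k)
  have "(\<Sum>i = a..<a + k. U $ p i $ p (Suc i)) + yseq U (Suc t) (p (a + k))
      \<le> yseq U (Suc t + k) (p a)"
    by (rule Suc.IH)
  moreover have "yseq U t (p (Suc (a + k))) + U $ p (a + k) $ p (Suc (a + k))
      \<le> yseq U (Suc t) (p (a + k))"
    by (rule yseq_Suc_ge)
  ultimately show ?case by (simp del: yseq.simps)
qed simp

text \<open>A finite maximum is attained, so following maximizers traces an optimal walk. Only the
  values of \<open>p\<close> up to \<open>t\<close> matter.\<close>

lemma yseq_walk_ex:
  "\<exists>p. p 0 = j \<and> yseq U t j = (\<Sum>i = 0..<t. U $ p i $ p (Suc i))"
proof (induction t arbitrary: j)
  case (Suc t)
  have "yseq U (Suc t) j \<in> range (\<lambda>k. yseq U t k + U $ j $ k)"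
    unfolding yseq.simps by (rule Max_in) auto
  then obtain k where k: "yseq U (Suc t) j = yseq U t k + U $ j $ k" by blast
  obtain p where p: "p 0 = k" "yseq U t k = (\<Sum>i = 0..<t. U $ p i $ p (Suc i))"
    using Suc.IH by blast
  define q where "q = case_nat j p"
  have "(\<Sum>i = 0..<Suc t. U $ q i $ q (Suc i)) = U $ j $ k + yseq U t k"
    by (subst sum.atLeast0_lessThan_Suc_shift) (simp add: q_def p)
  then show ?case using k by (intro exI[of _ q]) (simp add: q_def)
qed auto

lemma yseq_mono:
  assumes "\<And>j. U $ j $ j = 0" and "s \<le> t"
  shows "yseq U s j \<le> yseq U t j"
proof (rule lift_Suc_mono_le[OF _ \<open>s \<le> t\<close>])
  show "yseq U n j \<le> yseq U (Suc n) j" for n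
    using yseq_Suc_ge[of U n j j] assms(1) by simp
qed

lemma yseq_shorten:
  fixes U :: "real^'n^'n"
  assumes diag: "\<And>j. U $ j $ j = 0"
    and perm: "\<And>\<pi>. bij \<pi> \<Longrightarrow> (\<Sum>i\<in>UNIV. U $ i $ \<pi> i) \<le> 0"
    and t: "CARD('n) \<le> t"
  shows "\<exists>s<t. yseq U t j \<le> yseq U s j"
proof -
  let ?w = "\<lambda>p a b. \<Sum>i = a..<b. U $ p i $ p (Suc i)"
  obtain p where p: "p 0 = j" "yseq U t j = ?w p 0 t"
    using yseq_walk_ex by blast
  \<comment> \<open>Pigeonhole: \<open>t\<close> edges visit \<open>t + 1\<close> positions, more
    than there are vertices.\<close>
  have ex: "\<not> inj_on p {..t}"
    using card_inj_on_le[of p "{..t}" UNIV] t by auto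
  \<comment> \<open>Stopping at the first repetition keeps \<open>p\<close> injective before
    \<open>b\<close>, so the cycle closed at \<open>b\<close> is simple.\<close>
  define b where "b = (LEAST b. \<not> inj_on p {..b})"
  have b: "\<not> inj_on p {..b}"
    unfolding b_def by (rule LeastI[where P = "\<lambda>b. \<not> inj_on p {..b}", OF ex])
  have "b \<le> t"
    unfolding b_def by (rule Least_le[where P = "\<lambda>b. \<not> inj_on p {..b}", OF ex])
  have inj: "inj_on p {..<b}"
  proof (cases b)
    case (Suc c)
    have "inj_on p {..c}"
      using not_less_Least[where P = "\<lambda>b. \<not> inj_on p {..b}" and k = c] Suc
      unfolding b_def by simp
    then show ?thesis using Suc by (simp add: lessThan_Suc_atMost)
  qed simp
  have "{..b} = insert b {..<b}" by auto
  with b inj obtain a where a: "a < b" "p a = p b" by force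
  have "?w p a b \<le> 0"
    using a inj by (intro simple_cycle_nonpos diag perm) (auto intro: inj_on_subset)
  moreover have "?w p 0 t = ?w p 0 a + ?w p a b + ?w p b t"
    using a \<open>b \<le> t\<close> by (simp add: sum.atLeastLessThan_concat)
  \<comment> \<open>As \<open>p b = p a\<close>, the tail after the cycle can be attached directly
    to the prefix ending at \<open>a\<close>.\<close>
  moreover have "?w p b t \<le> yseq U (t - b) (p a)"
    using yseq_walk_le[where U = U and p = p and a = b and k = "t - b" and t = 0] \<open>b \<le> t\<close> a by simp
  moreover have "?w p 0 a + yseq U (t - b) (p a) \<le> yseq U (t - b + a) j"
    using yseq_walk_le[where U = U and p = p and a = 0 and k = a and t = "t - b"] p by simp
  ultimately have "yseq U t j \<le> yseq U (t - b + a) j" using p by linarith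
  moreover have "t - b + a < t" using a \<open>b \<le> t\<close> by linarith
  ultimately show ?thesis by blast
qed

lemma yseq_stationary:
  fixes U :: "real^'n^'n"
  assumes diag: "\<And>j. U $ j $ j = 0"
    and perm: "\<And>\<pi>. bij \<pi> \<Longrightarrow> (\<Sum>i\<in>UNIV. U $ i $ \<pi> i) \<le> 0"
    and t: "CARD('n) - 1 \<le> t"
  shows "yseq U t j = yseq U (CARD('n) - 1) j"
proof (rule antisym)
  show "yseq U t j \<le> yseq U (CARD('n) - 1) j"
  \<comment> \<open>The bound is proved for every \<open>t\<close>, since one cut may shorten the
    walk to fewer than \<open>CARD('n) - 1\<close> edges; from there monotonicity leads back
    up.\<close>
  proof (induction t rule: less_induct)
    case (less t)
    show ?case
    proof (cases "CARD('n) \<le> t")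
      case True
      then obtain s where "s < t" "yseq U t j \<le> yseq U s j"
        using yseq_shorten[OF diag perm] by blast
      then show ?thesis using less.IH[of s] by linarith
    next
      case False
      then show ?thesis by (intro yseq_mono diag) simp
    qed
  qed
  show "yseq U (CARD('n) - 1) j \<le> yseq U t j"
    by (rule yseq_mono[OF diag t])
qed

theorem theorem2p4:
  fixes V X :: "real^'n^'n"
  assumes "\<forall>i j. V $ i $ j \<ge> 0"
    and "max_weight_perfect_matching V X"
  shows "(\<forall>j. convergent (\<lambda>t. yseq (utility X V) t j)) \<and>
    (\<forall>j. \<forall>t \<ge> CARD('n) - 1.
       yseq (utility X V) (t + 1) j = yseq (utility X V) t j)"
proof -
  let ?y = "yseq (utility X V)"
  have stat: "?y t j = ?y (CARD('n) - 1) j" if "CARD('n) - 1 \<le> t" for t j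
    by (intro yseq_stationary utility_diagonal sum_utility_permutation_nonpos[OF assms(2)] that)
  have "convergent (\<lambda>t. ?y t j)" for j
  proof -
    have "(\<lambda>t. ?y t j) \<longlonglongrightarrow> ?y (CARD('n) - 1) j"
      by (intro tendsto_eventually eventually_sequentiallyI stat)
    then show ?thesis by (rule convergentI)
  qed
  moreover have "?y (t + 1) j = ?y t j" if "CARD('n) - 1 \<le> t" for t j
    using stat[OF that, of j] stat[of "t + 1" j] that by linarith
  ultimately show ?thesis by blast
qed

end
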